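(* Let $n$ be a positive integer. (a) If $1\le k<J\le n$ and $M$ is the $n\times n$ strictly upper triangular matrix with the $r(k,J)$-formation, i.e. $M(k,j)=2$ for $k+1\le j\le J$ and all other entries of $M$ are $0$, then $M$ is CN-realizable. (b) If $1\le I<l\le n$ and $M$ is the $n\times n$ strictly upper triangular matrix with the $c(I,l)$-formation, i.e. $M(i,l)=2$ for $I\le i\le l-1$ and all other entries of $M$ are $0$, then $M$ is CN-realizable.
   Context: An $n$-braid projection $B$ consists of $n$ strands in the plane, each running monotonically downward from one of $n$ points on an upper horizontal bar to one of $n$ points on a lower horizontal bar, meeting each other only in finitely many transverse double points (crossings), with no over/under information. The strands are named $s_1,\dots,s_n$ from left to right at the top. Combinatorially, $B$ is encoded by a finite word with letters in $\{1,\dots,n-1\}$: reading from top to bottom, the letter $k$ means that the two strands currently in positions $k$ and $k+1$ cross once and exchange positions (no reduction is assumed). The CN matrix $N(B)$ is the symmetric zero-diagonal $n\times n$ matrix whose $(i,j)$ entry ($i\neq j$) is the number of crossings between $s_i$ and $s_j$. CN matrices are represented by strictly upper triangular matrices (entries below the diagonal replaced by $0$): a strictly upper triangular $n\times n$ matrix $M$ is CN-realizable if there is an $n$-braid projection $B$ with $M(i,j)=N(B)(i,j)$ for all $1\le i<j\le n$. *)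

theory Defs
  imports "Jordan_Normal_Form.Matrix" "HOL-Combinatorics.Transposition"
begin

(* Strands, positions and the matrix indices of the mathematical text run over 1..n,
   whereas matrices of the library are indexed from 0. *)

definition entry :: "'a mat \<Rightarrow> nat \<Rightarrow> nat \<Rightarrow> 'a" where
  "entry M i j = M $$ (i - 1, j - 1)"

definition strictly_upper_triangular :: "nat \<Rightarrow> 'a::zero mat \<Rightarrow> bool" where
  "strictly_upper_triangular n M \<longleftrightarrow>
     M \<in> carrier_mat n n \<and> (\<forall>i\<in>{1..n}. \<forall>j\<in>{1..n}. j \<le> i \<longrightarrow> entry M i j = 0)"

(* An n-braid projection is encoded by the word of its crossings, read from top to bottom;
   the letter k is a crossing of the strands currently in positions k and k + 1. *)

definition braid_projection :: "nat \<Rightarrow> nat list \<Rightarrow> bool" where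
  "braid_projection n w \<longleftrightarrow> set w \<subseteq> {1..<n}"

(* strand_at w p is the (index of the) strand in position p just below the crossings of w;
   at the top, strand i is in position i. *)

definition strand_at :: "nat list \<Rightarrow> nat \<Rightarrow> nat" where
  "strand_at w = foldl (\<lambda>\<sigma> k. \<sigma> \<circ> transpose k (k + 1)) id w"

definition crossing_strands :: "nat list \<Rightarrow> nat \<Rightarrow> nat set" where
  "crossing_strands w t = {strand_at (take t w) (w ! t), strand_at (take t w) (w ! t + 1)}"

definition crossing_number :: "nat list \<Rightarrow> nat \<Rightarrow> nat \<Rightarrow> nat" where
  "crossing_number w i j = card {t. t < length w \<and> crossing_strands w t = {i, j}}"

definition CN_matrix :: "nat \<Rightarrow> nat list \<Rightarrow> nat mat" where
  "CN_matrix n w = mat n n (\<lambda>(a, b). if a = b then 0 else crossing_number w (a + 1) (b + 1))"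

definition CN_realizable :: "nat \<Rightarrow> nat mat \<Rightarrow> bool" where
  "CN_realizable n M \<longleftrightarrow> strictly_upper_triangular n M \<and>
     (\<exists>w. braid_projection n w \<and>
        (\<forall>i j. 1 \<le> i \<and> i < j \<and> j \<le> n \<longrightarrow> entry M i j = entry (CN_matrix n w) i j))"

definition r_formation :: "nat \<Rightarrow> nat \<Rightarrow> nat \<Rightarrow> nat mat \<Rightarrow> bool" where
  "r_formation n k J M \<longleftrightarrow>
     (\<forall>i\<in>{1..n}. \<forall>j\<in>{1..n}. entry M i j = (if i = k \<and> k + 1 \<le> j \<and> j \<le> J then 2 else 0))"

definition c_formation :: "nat \<Rightarrow> nat \<Rightarrow> nat \<Rightarrow> nat mat \<Rightarrow> bool" where
  "c_formation n I l M \<longleftrightarrow>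
     (\<forall>i\<in>{1..n}. \<forall>j\<in>{1..n}. entry M i j = (if j = l \<and> I \<le> i \<and> i \<le> l - 1 then 2 else 0))"

end

theory Submission
  imports Defs
begin

text \<open>
  A palindromic word \<^term>\<open>w @ rev w\<close> undoes itself, and its second half repeats the crossings
  of its first half between the same strands in the opposite order, so it doubles every crossing
  number of \<^term>\<open>w\<close>. It therefore suffices to let the strand \<open>k\<close> run to the right
  across the strands \<open>k + 1, \<dots>, J\<close> once, or the strand \<open>l\<close> to the left
  across \<open>l - 1, \<dots>, I\<close> once, and then to go back the same way.
\<close>

lemma strand_at_Nil [simp]: "strand_at [] = id"
  by (simp add: strand_at_def)

lemma strand_at_snoc: "strand_at (w @ [k]) = strand_at w \<circ> transpose k (k + 1)"
  by (simp add: strand_at_def)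

lemma strand_at_append: "strand_at (u @ v) = strand_at u \<circ> strand_at v"
proof (induction v rule: rev_induct)
  case (snoc k v)
  then show ?case
    using strand_at_snoc[of "u @ v" k] by (simp add: strand_at_snoc comp_assoc)
qed simp

lemma strand_at_single [simp]: "strand_at [k] = transpose k (k + 1)"
  by (simp add: strand_at_def)

lemma strand_at_Cons: "strand_at (k # w) = transpose k (k + 1) \<circ> strand_at w"
  using strand_at_append[of "[k]" w] by simp

text \<open>Peeling off the equal first and last letters leaves a shorter palindrome, the identity
  by induction, between two copies of one involution.\<close>

lemma strand_at_palindrome: "strand_at (w @ rev w) = id"
proof (induction w)
  case (Cons k w)
  have "strand_at ((k # w) @ rev (k # w)) =
      transpose k (k + 1) \<circ> strand_at (w @ rev w) \<circ> transpose k (k + 1)"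
    using strand_at_snoc[of "k # w @ rev w" k] by (simp add: strand_at_Cons)
  then show ?case
    using Cons by simp
qed simp

lemma crossing_number_Nil [simp]: "crossing_number [] i j = 0"
  by (simp add: crossing_number_def)

lemma crossing_number_snoc:
  "crossing_number (w @ [k]) i j =
    crossing_number w i j + of_bool ({strand_at w k, strand_at w (k + 1)} = {i, j})"
proof -
  define A where "A = {t. t < length w \<and> crossing_strands w t = {i, j}}"
  define B where "B = (if {strand_at w k, strand_at w (k + 1)} = {i, j} then {length w} else {})"
  have "crossing_strands (w @ [k]) t = crossing_strands w t" if "t < length w" for t
    using that by (simp add: crossing_strands_def nth_append)
  moreover have "crossing_strands (w @ [k]) (length w) = {strand_at w k, strand_at w (k + 1)}"
    by (simp add: crossing_strands_def)
  ultimately have "t < length (w @ [k]) \<and> crossing_strands (w @ [k]) t = {i, j} \<longleftrightarrow>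
      t \<in> A \<union> B" for t
    unfolding A_def B_def by (cases "t < length w"; cases "t = length w") simp_all
  then have "crossing_number (w @ [k]) i j = card (A \<union> B)"
    by (simp only: crossing_number_def Collect_mem_eq)
  moreover have "card (A \<union> B) = card A + card B"
    by (rule card_Un_disjoint) (simp_all add: A_def B_def)
  ultimately show ?thesis
    by (simp add: crossing_number_def A_def B_def)
qed

text \<open>Below the first crossing, \<open>w\<close> starts with the strands \<open>k\<close> and
  \<open>k + 1\<close> swapped, so what it counts for \<open>i\<close> and \<open>j\<close> is what
  it would count alone for their images under the transposition.\<close>

lemma crossing_number_Cons:
  "crossing_number (k # w) i j =
    of_bool ({k, k + 1} = {i, j}) +
    crossing_number w (transpose k (k + 1) i) (transpose k (k + 1) j)"
proof (induction w rule: rev_induct)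
  case Nil
  then show ?case
    using crossing_number_snoc[of "[]" k i j] by simp
next
  case (snoc m w)
  \<comment> \<open>The pair crossing at \<open>m\<close> in \<open>k # w\<close> is the image under
    the transposition of the pair crossing there in \<open>w\<close>; since the transposition is an
    injective involution, it moves over to \<open>i\<close> and \<open>j\<close>.\<close>
  have "transpose k (k + 1) ` A = {i, j} \<longleftrightarrow>
      A = {transpose k (k + 1) i, transpose k (k + 1) j}" for A
    using inj_image_eq_iff[OF inj_transpose, of k "k + 1" A
      "{transpose k (k + 1) i, transpose k (k + 1) j}"] by simp
  from this[of "{strand_at w m, strand_at w (m + 1)}"] show ?case
    using crossing_number_snoc[of "k # w" m i j] snoc
    by (simp add: crossing_number_snoc strand_at_Cons)
qed

lemma crossing_number_palindrome:
  "crossing_number (w @ rev w) i j = 2 * crossing_number w i j"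
\<comment> \<open>\<open>crossing_number_Cons\<close> relabels the strands, so the induction
  hypothesis is needed at the swapped pair.\<close>
proof (induction w arbitrary: i j)
  case (Cons k w)
  \<comment> \<open>The inner palindrome cancels, so the last letter \<open>k\<close> finds the two
    strands of the first crossing and crosses them again.\<close>
  have "strand_at (k # w @ rev w) = transpose k (k + 1)"
    using strand_at_palindrome[of w] by (simp add: strand_at_Cons)
  then have "crossing_number ((k # w) @ rev (k # w)) i j =
      crossing_number (k # w @ rev w) i j + of_bool ({k + 1, k} = {i, j})"
    using crossing_number_snoc[of "k # w @ rev w" k i j] by simp
  then show ?case
    using Cons by (simp add: crossing_number_Cons insert_commute)
qed simp

lemma strand_at_upt:
  assumes "k \<le> J"
  shows "strand_at [k..<J] J = k" and "p > J \<Longrightarrow> strand_at [k..<J] p = p"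
proof -
  have "strand_at [k..<J] J = k \<and> (\<forall>p>J. strand_at [k..<J] p = p)"
    using assms
    by (induction J rule: dec_induct) (simp_all add: strand_at_snoc transpose_def)
  then show "strand_at [k..<J] J = k" "p > J \<Longrightarrow> strand_at [k..<J] p = p"
    by auto
qed

text \<open>When the letter \<open>J\<close> is appended, strand \<open>k\<close> has reached
  position \<open>J\<close> and strand \<open>J + 1\<close> has not moved yet, so exactly this pair
  is added. The assumption \<open>i < j\<close> fixes the order in the unordered pair.\<close>

lemma crossing_number_upt:
  assumes "k \<le> J" "i < j"
  shows "crossing_number [k..<J] i j = of_bool (i = k \<and> k < j \<and> j \<le> J)"
  using assms(1)
proof (induction J rule: dec_induct)
  case (step J)
  then show ?case
    using assms(2) strand_at_upt[of k J]
    by (auto simp: crossing_number_snoc doubleton_eq_iff)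
qed auto

lemma strand_at_rev_upt:
  assumes "I \<le> l"
  shows "strand_at (rev [I..<l]) I = l" and "p < I \<Longrightarrow> strand_at (rev [I..<l]) p = p"
proof -
  have "strand_at (rev [I..<l]) I = l \<and> (\<forall>p<I. strand_at (rev [I..<l]) p = p)"
    using assms
    \<comment> \<open>The word reads \<open>l - 1\<close>, ..., \<open>I\<close>, so lowering
      \<open>I\<close> by one appends a letter at its end; hence the downward induction from
      \<open>l\<close>.\<close>
    by (induction I rule: inc_induct)
       (simp_all add: upt_conv_Cons strand_at_snoc transpose_def)
  then show "strand_at (rev [I..<l]) I = l" "p < I \<Longrightarrow> strand_at (rev [I..<l]) p = p"
    by auto
qed

text \<open>Mirror image of the ascending run: each new letter \<open>I\<close> crosses strand
  \<open>l\<close>, now in position \<open>I + 1\<close>, with the unmoved strand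
  \<open>I\<close>.\<close>

lemma crossing_number_rev_upt:
  assumes "I \<le> l" "i < j"
  shows "crossing_number (rev [I..<l]) i j = of_bool (j = l \<and> I \<le> i \<and> i < l)"
  using assms(1)
proof (induction I rule: inc_induct)
  case (step I)
  then show ?case
    using assms(2) strand_at_rev_upt[of "Suc I" l]
    by (auto simp: upt_conv_Cons crossing_number_snoc doubleton_eq_iff)
qed (use assms(2) in auto)

lemma CN_realizable_palindrome:
  assumes "strictly_upper_triangular n M" "set w \<subseteq> {1..<n}"
    and "\<And>i j. 1 \<le> i \<Longrightarrow> i < j \<Longrightarrow> j \<le> n \<Longrightarrow> entry M i j = 2 * crossing_number w i j"
  shows "CN_realizable n M"
  unfolding CN_realizable_def
proof (intro conjI exI[of _ "w @ rev w"] allI impI)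
  fix i j assume ij: "1 \<le> i \<and> i < j \<and> j \<le> n"
  \<comment> \<open>The bound \<open>1 \<le> i\<close> makes the shift between 1-based and 0-based
    indices exact, and \<open>i < j\<close> avoids the zero diagonal.\<close>
  then have "entry (CN_matrix n (w @ rev w)) i j = crossing_number (w @ rev w) i j"
    by (auto simp: entry_def CN_matrix_def)
  then show "entry M i j = entry (CN_matrix n (w @ rev w)) i j"
    using assms(3) ij by (simp add: crossing_number_palindrome)
qed (use assms in \<open>auto simp: braid_projection_def\<close>)

theorem proposition13:
  fixes n :: nat
  assumes "n \<ge> 1"
  shows "(\<forall>k J (M :: nat mat). 1 \<le> k \<and> k < J \<and> J \<le> n \<and>
            strictly_upper_triangular n M \<and> r_formation n k J M \<longrightarrow> CN_realizable n M)
       \<and> (\<forall>I l (M :: nat mat). 1 \<le> I \<and> I < l \<and> l \<le> n \<and>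
            strictly_upper_triangular n M \<and> c_formation n I l M \<longrightarrow> CN_realizable n M)"
proof (intro conjI allI impI; elim conjE)
  fix k J and M :: "nat mat"
  assume *: "1 \<le> k" "k < J" "J \<le> n" "strictly_upper_triangular n M" "r_formation n k J M"
  show "CN_realizable n M"
  proof (rule CN_realizable_palindrome[of n M "[k..<J]"])
    fix i j assume "1 \<le> i" "i < j" "j \<le> n"
    then show "entry M i j = 2 * crossing_number [k..<J] i j"
      using * by (auto simp: r_formation_def crossing_number_upt)
  qed (use * in auto)
next
  fix I l and M :: "nat mat"
  assume *: "1 \<le> I" "I < l" "l \<le> n" "strictly_upper_triangular n M" "c_formation n I l M"
  show "CN_realizable n M"
  proof (rule CN_realizable_palindrome[of n M "rev [I..<l]"])
    fix i j assume "1 \<le> i" "i < j" "j \<le> n"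
    then show "entry M i j = 2 * crossing_number (rev [I..<l]) i j"
      using * by (auto simp: c_formation_def crossing_number_rev_upt)
  qed (use * in auto)
qed

end
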